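(* Let $\mathbf{x}_1,\dots,\mathbf{x}_m\in\mathbb{R}^n$, $\mathbf{y}\in\{-1,1\}^m$, $0<c<C$, $s\in\{1,\dots,m\}$ and $\eta>0$. A point $\mathbf{z}^*=(\boldsymbol\alpha^*;b^* )\in\mathbb{R}^m\times\mathbb{R}$ is an $\eta$-stationary point of the problem $$\min_{\boldsymbol\alpha\in\mathbb{R}^m} D(\boldsymbol\alpha)\quad\text{s.t.}\quad \langle\boldsymbol\alpha,\mathbf{y}\rangle=0,\ \ \|\boldsymbol\alpha\|_0\le s$$ if and only if there exists $T_*\in\mathbb{T}_s(\boldsymbol\alpha^*-\eta g(\mathbf{z}^* ))$ such that $$F(\mathbf{z}^*;T_* ):=\begin{bmatrix} g_{T_*}(\mathbf{z}^* )\\ \boldsymbol\alpha^*_{\overline{T}_*}\\ \langle\boldsymbol\alpha^*_{T_*},\mathbf{y}_{T_*}\rangle\end{bmatrix}=0 .$$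
   Context: $D(\boldsymbol\alpha)=\frac12\|Q\boldsymbol\alpha\|^2+\frac12\langle E(\boldsymbol\alpha)\boldsymbol\alpha,\boldsymbol\alpha\rangle-\langle\mathbf{1},\boldsymbol\alpha\rangle$, where $Q:=[y_1\mathbf{x}_1\ \cdots\ y_m\mathbf{x}_m]\in\mathbb{R}^{n\times m}$, $\mathbf{1}$ is the all-ones vector, and $E(\boldsymbol\alpha)$ is the diagonal matrix with $E_{ii}(\boldsymbol\alpha)=1/C$ if $\alpha_i\ge0$, $1/c$ if $\alpha_i<0$. $H(\boldsymbol\alpha):=Q^\top Q+E(\boldsymbol\alpha)$, and for $\mathbf{z}=(\boldsymbol\alpha;b)$, $g(\mathbf{z}):=H(\boldsymbol\alpha)\boldsymbol\alpha-\mathbf{1}+b\,\mathbf{y}\in\mathbb{R}^m$ (that is, $\nabla D(\boldsymbol\alpha)+b\,\mathbf{y}$). $\|\boldsymbol\alpha\|_0$ is the number of nonzero entries. For $T\subseteq[m]:=\{1,\dots,m\}$, $\overline T=[m]\setminus T$, a subscript $T$ on a vector denotes the subvector indexed by $T$, and $g_T(\mathbf{z})=(g(\mathbf{z}))_T$. $\mathbb{T}_s(\boldsymbol\alpha):=\{T\subseteq[m]: |T|=s,\ |\alpha_i|\ge|\alpha_j|\ \forall i\in T,\ \forall j\notin T\}$. $\mathbb{P}_s(\boldsymbol\alpha):=\operatorname{argmin}_{\mathbf{u}}\{\|\mathbf{u}-\boldsymbol\alpha\|:\|\mathbf{u}\|_0\le s\}$ (a set of minimizers), equivalently the set of vectors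 obtained by keeping the entries of $\boldsymbol\alpha$ on some $T\in\mathbb{T}_s(\boldsymbol\alpha)$ and setting the others to zero. $\mathbf{z}^*=(\boldsymbol\alpha^*;b^* )$ is an $\eta$-stationary point of the problem if $\boldsymbol\alpha^*\in\mathbb{P}_s\big[\boldsymbol\alpha^*-\eta g(\mathbf{z}^* )\big]$ and $\langle\boldsymbol\alpha^*,\mathbf{y}\rangle=0$. *)

theory Defs
  imports "HOL-Analysis.Analysis"
begin

definition Qmat :: "('m \<Rightarrow> real^'n) \<Rightarrow> real^'m \<Rightarrow> real^('m::finite)^('n::finite)" where
  "Qmat x y = (\<chi> k i. y $ i * x i $ k)"

definition Emat :: "real \<Rightarrow> real \<Rightarrow> real^'m \<Rightarrow> real^('m::finite)^'m" where
  "Emat C c \<alpha> = (\<chi> i j. if i = j then (if \<alpha> $ i \<ge> 0 then 1 / C else 1 / c) else 0)"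

definition D_obj :: "('m \<Rightarrow> real^'n) \<Rightarrow> real^'m \<Rightarrow> real \<Rightarrow> real \<Rightarrow> real^('m::finite) \<Rightarrow> real" where
  "D_obj x y C c \<alpha> =
     1/2 * (norm (Qmat x y *v \<alpha>))\<^sup>2 + 1/2 * ((Emat C c \<alpha> *v \<alpha>) \<bullet> \<alpha>) - vec 1 \<bullet> \<alpha>"

definition Hmat :: "('m \<Rightarrow> real^('n::finite)) \<Rightarrow> real^'m \<Rightarrow> real \<Rightarrow> real \<Rightarrow> real^'m \<Rightarrow> real^('m::finite)^'m" where
  "Hmat x y C c \<alpha> = transpose (Qmat x y) ** Qmat x y + Emat C c \<alpha>"

definition g_fun :: "('m \<Rightarrow> real^('n::finite)) \<Rightarrow> real^'m \<Rightarrow> real \<Rightarrow> real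
    \<Rightarrow> (real^('m::finite)) \<times> real \<Rightarrow> real^'m" where
  "g_fun x y C c = (\<lambda>(\<alpha>, b). Hmat x y C c \<alpha> *v \<alpha> - vec 1 + b *\<^sub>R y)"

definition l0norm :: "real^('m::finite) \<Rightarrow> nat" where
  "l0norm v = card {i. v $ i \<noteq> 0}"

definition Tset :: "nat \<Rightarrow> real^('m::finite) \<Rightarrow> 'm set set" where
  "Tset s \<alpha> = {T. card T = s \<and> (\<forall>i\<in>T. \<forall>j\<in>-T. \<bar>\<alpha> $ i\<bar> \<ge> \<bar>\<alpha> $ j\<bar>)}"

definition Pset :: "nat \<Rightarrow> real^('m::finite) \<Rightarrow> (real^'m) set" where
  "Pset s \<alpha> = {u. is_arg_min (\<lambda>u. norm (u - \<alpha>)) (\<lambda>u. l0norm u \<le> s) u}"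

text \<open>\<open>\<eta>\<close>-stationarity for minimising \<^term>\<open>D_obj x y C c \<alpha>\<close> subject to
  \<^term>\<open>\<alpha> \<bullet> y = 0\<close> and \<^term>\<open>l0norm \<alpha> \<le> s\<close>. The objective enters through
  \<^const>\<open>g_fun\<close>, whose value at \<^term>\<open>(\<alpha>, b)\<close> is the gradient of the objective plus
  \<^term>\<open>b *\<^sub>R y\<close> (see \<open>g_fun_gradient\<close> below).\<close>

definition eta_stationary :: "('m \<Rightarrow> real^('n::finite)) \<Rightarrow> real^'m \<Rightarrow> real \<Rightarrow> real \<Rightarrow> nat \<Rightarrow> real
    \<Rightarrow> (real^('m::finite)) \<times> real \<Rightarrow> bool" where
  "eta_stationary x y C c s \<eta> z \<longleftrightarrow>
     fst z \<in> Pset s (fst z - \<eta> *\<^sub>R g_fun x y C c z) \<and> fst z \<bullet> y = 0"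

text \<open>The subvector of \<open>v\<close> indexed by \<open>T\<close>, embedded in the full space by padding with zeros
  outside \<open>T\<close>. It vanishes iff all entries indexed by \<open>T\<close> do, and inner products of
  subvectors over the same \<open>T\<close> are unaffected by the padding.\<close>

definition subvec :: "real^'m \<Rightarrow> 'm set \<Rightarrow> real^('m::finite)" where
  "subvec v T = (\<chi> i. if i \<in> T then v $ i else 0)"

text \<open>The three blocks of the stacked vector are the components of a triple.\<close>

definition F_fun :: "('m \<Rightarrow> real^('n::finite)) \<Rightarrow> real^'m \<Rightarrow> real \<Rightarrow> real
    \<Rightarrow> (real^('m::finite)) \<times> real \<Rightarrow> 'm set \<Rightarrow> (real^'m) \<times> (real^'m) \<times> real" where
  "F_fun x y C c z T =
     (subvec (g_fun x y C c z) T, subvec (fst z) (- T), subvec (fst z) T \<bullet> subvec y T)"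

lemma piecewise_square_deriv:
  fixes C c t :: real
  shows "((\<lambda>t. (if t \<ge> 0 then 1 / C else 1 / c) * t\<^sup>2) has_real_derivative
           2 * ((if t \<ge> 0 then 1 / C else 1 / c) * t)) (at t)"
proof (cases "t = 0")
  case True
  define k where "k = (\<lambda>t::real. max t 0 * (1 / C) + min t 0 * (1 / c))"
  have "isCont k 0" unfolding k_def by (intro continuous_intros)
  moreover have "(if z \<ge> 0 then 1 / C else 1 / c) * z\<^sup>2 = k z * z" for z
    by (auto simp: k_def power2_eq_square)
  ultimately show ?thesis unfolding True CARAT_DERIV
    by (intro exI[of _ k]) (auto simp: k_def)
next
  case False
  have sq: "((\<lambda>t. a * t\<^sup>2) has_real_derivative 2 * (a * t)) (at t)" for a :: real
    by (auto intro!: derivative_eq_intros)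
  from False consider "t > 0" | "t < 0" by linarith
  then show ?thesis
  proof cases
    case 1
    have "((\<lambda>t. 1 / C * t\<^sup>2) has_real_derivative 2 * (1 / C * t)) (at t)"
      by (rule sq)
    then have "((\<lambda>t. (if t \<ge> 0 then 1 / C else 1 / c) * t\<^sup>2) has_real_derivative 2 * (1 / C * t)) (at t)"
      by (rule has_field_derivative_transform_within_open[of _ _ _ "{0<..}"]) (use 1 in auto)
    with 1 show ?thesis by simp
  next
    case 2
    have "((\<lambda>t. 1 / c * t\<^sup>2) has_real_derivative 2 * (1 / c * t)) (at t)"
      by (rule sq)
    then have "((\<lambda>t. (if t \<ge> 0 then 1 / C else 1 / c) * t\<^sup>2) has_real_derivative 2 * (1 / c * t)) (at t)"
      by (rule has_field_derivative_transform_within_open[of _ _ _ "{..<0}"]) (use 2 in auto)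
    with 2 show ?thesis by simp
  qed
qed

lemma Emat_mult: "(Emat C c \<alpha> *v \<beta>) $ i = (if \<alpha> $ i \<ge> 0 then 1 / C else 1 / c) * \<beta> $ i"
proof -
  have "(Emat C c \<alpha> *v \<beta>) $ i =
      (\<Sum>j\<in>UNIV. if i = j then (if \<alpha> $ i \<ge> 0 then 1 / C else 1 / c) * \<beta> $ j else 0)"
    unfolding matrix_vector_mult_def Emat_def vec_lambda_beta by (rule sum.cong) simp_all
  then show ?thesis by simp
qed

lemma g_fun_gradient:
  "GDERIV (D_obj x y C c) \<alpha> :> g_fun x y C c (\<alpha>, b) - b *\<^sub>R y"
proof -
  define e where "e = (\<lambda>t::real. if t \<ge> 0 then 1 / C else 1 / c)"
  let ?Q = "Qmat x y"
  have D: "D_obj x y C c = (\<lambda>\<alpha>. 1/2 * ((?Q *v \<alpha>) \<bullet> (?Q *v \<alpha>))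
      + 1/2 * (\<Sum>i\<in>UNIV. e (\<alpha> $ i) * (\<alpha> $ i)\<^sup>2) - vec 1 \<bullet> \<alpha>)"
    by (rule ext, simp add: D_obj_def dot_square_norm inner_vec_def[of "Emat _ _ _ *v _"]
        Emat_mult e_def mult.assoc power2_eq_square[of "_ $ _"])
  have lin: "((\<lambda>\<alpha>. ?Q *v \<alpha>) has_derivative (\<lambda>h. ?Q *v h)) (at \<alpha>)"
    by (intro bounded_linear_imp_has_derivative matrix_vector_mul_bounded_linear)
  have sq: "((\<lambda>\<alpha>. e (\<alpha> $ i) * (\<alpha> $ i)\<^sup>2) has_derivative (\<lambda>h. 2 * (e (\<alpha> $ i) * \<alpha> $ i) * (h $ i))) (at \<alpha>)"
    for i
    using has_derivative_compose[OF bounded_linear_imp_has_derivative[OF bounded_linear_vec_nth]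
        piecewise_square_deriv[of C c "\<alpha> $ i", unfolded has_field_derivative_def]]
    by (simp add: e_def)
  have "(D_obj x y C c has_derivative (\<lambda>h. 1/2 * ((?Q *v \<alpha>) \<bullet> (?Q *v h) + (?Q *v h) \<bullet> (?Q *v \<alpha>))
      + 1/2 * (\<Sum>i\<in>UNIV. 2 * (e (\<alpha> $ i) * \<alpha> $ i) * (h $ i)) - vec 1 \<bullet> h)) (at \<alpha>)"
    unfolding D
    by (rule has_derivative_diff has_derivative_add has_derivative_mult_right
        has_derivative_inner[OF lin lin] has_derivative_sum[OF sq]
        has_derivative_inner_right[OF has_derivative_ident])+
  moreover have "1/2 * ((?Q *v \<alpha>) \<bullet> (?Q *v h) + (?Q *v h) \<bullet> (?Q *v \<alpha>))
      + 1/2 * (\<Sum>i\<in>UNIV. 2 * (e (\<alpha> $ i) * \<alpha> $ i) * (h $ i)) - vec 1 \<bullet> h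
      = h \<bullet> (g_fun x y C c (\<alpha>, b) - b *\<^sub>R y)" for h
  proof -
    have "(?Q *v h) \<bullet> (?Q *v \<alpha>) = h \<bullet> ((transpose ?Q ** ?Q) *v \<alpha>)"
      by (metis dot_lmul_matrix inner_commute matrix_vector_mul_assoc transpose_matrix_vector)
    moreover have "1/2 * (\<Sum>i\<in>UNIV. 2 * (e (\<alpha> $ i) * \<alpha> $ i) * (h $ i)) = h \<bullet> (Emat C c \<alpha> *v \<alpha>)"
      by (simp add: inner_vec_def Emat_mult e_def sum_distrib_left mult_ac)
    ultimately show ?thesis
      by (simp add: g_fun_def Hmat_def matrix_vector_mult_add_rdistrib inner_diff_right
          inner_add_right inner_commute[of 1] inner_commute[of "?Q *v \<alpha>"])
  qed
  ultimately show ?thesis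
    unfolding gderiv_def by simp
qed

end

theory Submission
  imports Defs
begin

text \<open>The set \<^term>\<open>Pset s a\<close> consists exactly of the truncations of \<open>a\<close> to the index sets in
  \<^term>\<open>Tset s a\<close>. For \<open>a = \<alpha> - \<eta> g\<close>, the vector \<open>\<alpha>\<close> equals the truncation of \<open>a\<close>
  to \<open>T\<close> iff \<open>\<eta> g\<close> vanishes on \<open>T\<close> and \<open>\<alpha>\<close> vanishes off \<open>T\<close>; in that case
  the inner product of \<open>\<alpha>\<close> and \<open>y\<close> only sees the indices in \<open>T\<close>.\<close>

lemma subvec_nth [simp]: "subvec v T $ i = (if i \<in> T then v $ i else 0)"
  by (simp add: subvec_def)

lemma l0norm_subvec_le: "l0norm (subvec v T) \<le> card T"
  unfolding l0norm_def by (rule card_mono) auto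

lemma norm_vec_squared: "(norm v)\<^sup>2 = (\<Sum>i\<in>UNIV. (v $ i)\<^sup>2)"
  for v :: "real^'m::finite"
  unfolding power2_norm_eq_inner inner_vec_def by (simp add: power2_eq_square)

text \<open>Outside \<open>S\<close> the vector \<open>u\<close> vanishes and contributes the same
  error as the zero vector. Using the full norm of \<open>a\<close> leaves only sums over
  \<open>S\<close> to compare.\<close>

lemma norm_diff_squared_split:
  fixes u a :: "real^'m::finite"
  assumes "{i. u $ i \<noteq> 0} \<subseteq> S"
  shows "(norm (u - a))\<^sup>2 = (\<Sum>i\<in>S. (u $ i - a $ i)\<^sup>2) + (norm a)\<^sup>2 - (\<Sum>i\<in>S. (a $ i)\<^sup>2)"
proof -
  have eq: "(\<Sum>i\<in>-S. (u $ i - a $ i)\<^sup>2) = (\<Sum>i\<in>-S. (a $ i)\<^sup>2)"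
  proof (rule sum.cong)
    show "(u $ i - a $ i)\<^sup>2 = (a $ i)\<^sup>2" if "i \<in> - S" for i
    proof -
      have "u $ i = 0" using assms that by auto
      then show ?thesis by simp
    qed
  qed simp
  have split: "sum f UNIV = sum f S + sum f (-S)" for f :: "'m \<Rightarrow> real"
    using sum.Int_Diff[of UNIV f S] by (simp add: Compl_eq_Diff_UNIV)
  show ?thesis
    unfolding norm_vec_squared split[of "\<lambda>i. ((u - a) $ i)\<^sup>2"] split[of "\<lambda>i. (a $ i)\<^sup>2"]
    using eq by simp
qed

lemma norm_subvec_diff_squared:
  "(norm (subvec a T - a))\<^sup>2 = (norm a)\<^sup>2 - (\<Sum>i\<in>T. (a $ i)\<^sup>2)"
  by (subst norm_diff_squared_split[of _ T]) auto

text \<open>After cancelling the common part \<open>S \<inter> T\<close>, the rest of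
  \<open>T\<close> has at least as many elements as the rest of \<open>S\<close>, and each of its
  values is at least as large.\<close>

lemma sum_le_sum_dominating:
  fixes f :: "'a \<Rightarrow> real"
  assumes fin: "finite S" "finite T" and card: "card S \<le> card T"
    and nonneg: "\<And>i. 0 \<le> f i"
    and dom: "\<And>i j. i \<in> T \<Longrightarrow> j \<notin> T \<Longrightarrow> f j \<le> f i"
  shows "sum f S \<le> sum f T"
proof (cases "S - T = {}")
  case True
  then show ?thesis
    using fin nonneg by (intro sum_mono2) auto
next
  case False
  \<comment> \<open>\<open>M\<close> separates the two differences: it bounds \<open>f\<close> from
    above on \<open>S - T\<close> and, being attained outside \<open>T\<close>, from below on
    \<open>T - S\<close>.\<close>
  define M where "M = Max (f ` (S - T))"
  have M: "f i \<le> M" if "i \<in> S - T" for i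
    using that fin unfolding M_def by auto
  have "M \<in> f ` (S - T)"
    unfolding M_def using False fin by (intro Max_in) auto
  then obtain k where k: "k \<in> S - T" "M = f k" by auto
  have "card (S - T) \<le> card (T - S)"
    using card_le_sym_Diff[OF fin card] .
  have "sum f (S - T) \<le> of_nat (card (S - T)) * M"
    using M by (intro sum_bounded_above) auto
  also have "\<dots> \<le> of_nat (card (T - S)) * M"
    using \<open>card (S - T) \<le> card (T - S)\<close> nonneg k by (intro mult_right_mono) auto
  also have "\<dots> \<le> sum f (T - S)"
    using dom k by (intro sum_bounded_below) auto
  finally have "sum f (S - T) \<le> sum f (T - S)" .
  moreover have "sum f S = sum f (S \<inter> T) + sum f (S - T)"
    by (rule sum.Int_Diff[OF fin(1)])
  moreover have "sum f T = sum f (S \<inter> T) + sum f (T - S)"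
    using sum.Int_Diff[OF fin(2), of f S] by (simp only: Int_commute)
  ultimately show ?thesis by simp
qed

text \<open>The squared error of any \<open>v\<close> is at least the squared norm of
  \<open>a\<close> minus the mass of \<open>a\<close> on the support of \<open>v\<close>. Truncation
  to \<open>T\<close> attains this bound for \<open>T\<close>, whose mass is maximal.\<close>

lemma subvec_in_Pset:
  assumes "T \<in> Tset s a"
  shows "subvec a T \<in> Pset s a"
proof -
  have card: "card T = s" and dom: "\<And>i j. i \<in> T \<Longrightarrow> j \<notin> T \<Longrightarrow> \<bar>a $ j\<bar> \<le> \<bar>a $ i\<bar>"
    using assms by (auto simp: Tset_def)
  have "norm (subvec a T - a) \<le> norm (v - a)" if v: "l0norm v \<le> s" for v
  proof -
    let ?S = "{i. v $ i \<noteq> 0}"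
    have "(\<Sum>i\<in>?S. (a $ i)\<^sup>2) \<le> (\<Sum>i\<in>T. (a $ i)\<^sup>2)"
      using v card dom by (intro sum_le_sum_dominating) (auto simp: l0norm_def abs_le_square_iff)
    moreover have "(norm (v - a))\<^sup>2 \<ge> (norm a)\<^sup>2 - (\<Sum>i\<in>?S. (a $ i)\<^sup>2)"
      by (subst norm_diff_squared_split[OF order_refl]) (simp add: sum_nonneg)
    ultimately have "(norm (subvec a T - a))\<^sup>2 \<le> (norm (v - a))\<^sup>2"
      by (simp add: norm_subvec_diff_squared)
    then show ?thesis by (rule power2_le_imp_le) simp
  qed
  then show ?thesis
    using l0norm_subvec_le[of a T] card by (auto simp: Pset_def is_arg_min_def not_less)
qed

text \<open>Minimality of \<open>u\<close> is tested only against truncations of \<open>a\<close>: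
  one identifies the entries of \<open>u\<close>, the others give the ordering required by
  \<open>Tset\<close>.\<close>

lemma Pset_imp_subvec:
  fixes a :: "real^'m::finite"
  assumes u: "u \<in> Pset s a" and s: "s \<le> CARD('m)"
  shows "\<exists>T\<in>Tset s a. u = subvec a T"
proof -
  have u0: "card {i. u $ i \<noteq> 0} \<le> s"
    using u by (simp add: Pset_def is_arg_min_def l0norm_def)
  have min: "(norm (u - a))\<^sup>2 \<le> (norm (subvec a T - a))\<^sup>2" if "card T \<le> s" for T
    using u that l0norm_subvec_le[of a T]
    by (force simp: Pset_def is_arg_min_def not_less intro!: power_mono)
  \<comment> \<open>The support of \<open>u\<close> may have fewer than \<open>s\<close> elements,
    while \<open>Tset\<close> asks for exactly \<open>s\<close>, so it is padded.\<close>
  obtain S where S: "{i. u $ i \<noteq> 0} \<subseteq> S" "card S = s"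
    using exists_subset_between[OF u0 s] by auto
  \<comment> \<open>The truncation of \<open>a\<close> to \<open>S\<close> is a feasible competitor
    with no error on \<open>S\<close> and the same error as \<open>u\<close> elsewhere.\<close>
  have "(\<Sum>i\<in>S. (u $ i - a $ i)\<^sup>2) \<le> 0"
    using min[of S] S by (simp add: norm_subvec_diff_squared norm_diff_squared_split[OF S(1)])
  then have "(\<Sum>i\<in>S. (u $ i - a $ i)\<^sup>2) = 0"
    by (intro antisym sum_nonneg) auto
  then have "\<forall>i\<in>S. u $ i = a $ i"
    by (subst (asm) sum_nonneg_eq_0_iff) auto
  then have u_eq: "u = subvec a S"
    using S(1) by (auto simp: vec_eq_iff)
  have "\<bar>a $ j\<bar> \<le> \<bar>a $ i\<bar>" if ij: "i \<in> S" "j \<notin> S" for i j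
  proof -
    \<comment> \<open>Exchanging \<open>i\<close> for \<open>j\<close> cannot bring the truncation closer to \<open>a\<close>.\<close>
    let ?S' = "insert j (S - {i})"
    have "card ?S' = s"
      using ij S(2) by (simp add: card.insert_remove card_Diff_singleton card_gt_0_iff)
        (metis Suc_pred card_gt_0_iff empty_iff finite)
    then have "(\<Sum>k\<in>?S'. (a $ k)\<^sup>2) \<le> (\<Sum>k\<in>S. (a $ k)\<^sup>2)"
      using min[of ?S'] by (simp add: u_eq norm_subvec_diff_squared)
    then have "(a $ j)\<^sup>2 \<le> (a $ i)\<^sup>2"
      using ij by (simp add: sum_diff1)
    then show ?thesis by (simp add: abs_le_square_iff)
  qed
  then have "S \<in> Tset s a"
    using S(2) by (auto simp: Tset_def)
  with u_eq show ?thesis by blast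
qed

lemma Pset_eq:
  fixes a :: "real^'m::finite"
  assumes "s \<le> CARD('m)"
  shows "Pset s a = subvec a ` Tset s a"
  using subvec_in_Pset Pset_imp_subvec[OF _ assms] by blast

lemma eq_subvec_step_iff:
  fixes \<alpha> g :: "real^'m::finite"
  assumes "\<eta> \<noteq> 0"
  shows "\<alpha> = subvec (\<alpha> - \<eta> *\<^sub>R g) T \<longleftrightarrow> subvec g T = 0 \<and> subvec \<alpha> (- T) = 0"
  using assms by (auto simp: vec_eq_iff)

lemma inner_subvec:
  assumes "subvec v (- T) = 0"
  shows "subvec v T \<bullet> subvec w T = v \<bullet> w"
proof -
  have "v $ i = 0" if "i \<notin> T" for i
    using arg_cong[OF assms, of "\<lambda>v. v $ i"] that by simp
  then show ?thesis
    unfolding inner_vec_def by (intro sum.cong) auto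
qed

theorem theorem2p3:
  fixes x :: "'m::finite \<Rightarrow> real^'n::finite"
    and y :: "real^'m"
    and C c \<eta> :: real
    and s :: nat
    and z :: "(real^'m) \<times> real"
  assumes "\<forall>i. y $ i \<in> {-1, 1}"
    and "0 < c" and "c < C"
    and "1 \<le> s" and "s \<le> CARD('m)"
    and "0 < \<eta>"
  shows "eta_stationary x y C c s \<eta> z \<longleftrightarrow>
    (\<exists>T \<in> Tset s (fst z - \<eta> *\<^sub>R g_fun x y C c z). F_fun x y C c z T = 0)"
proof -
  let ?g = "g_fun x y C c z"
  have "\<eta> \<noteq> 0" using \<open>0 < \<eta>\<close> by simp
  \<comment> \<open>With \<open>T\<close> fixed, the balance condition
    \<open>fst z \<bullet> y = 0\<close> is free of \<open>T\<close> and can leave the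
    existential.\<close>
  have "F_fun x y C c z T = 0 \<longleftrightarrow> fst z = subvec (fst z - \<eta> *\<^sub>R ?g) T \<and> fst z \<bullet> y = 0" for T
    unfolding eq_subvec_step_iff[OF \<open>\<eta> \<noteq> 0\<close>]
    by (auto simp: F_fun_def zero_prod_def inner_subvec)
  then show ?thesis
    unfolding eta_stationary_def Pset_eq[OF \<open>s \<le> CARD('m)\<close>] by blast
qed

end
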